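(* Let $\mathfrak{g}$ be a simple, finite-dimensional complex Lie algebra. If $\mathfrak{g}$ is not isomorphic to $\mathfrak{f}_4$, then $\mathfrak{g}$ is not prelie, that is, there is no prelie product on $\mathfrak{g}$ inducing its Lie bracket.
   Context: A (left) prelie product on a vector space $\mathfrak{g}$ is a bilinear product $\star$ such that $(x\star y)\star z-x\star(y\star z)=(y\star x)\star z-y\star(x\star z)$ for all $x,y,z$. It induces the bracket of the Lie algebra $\mathfrak{g}$ if $[x,y]=x\star y-y\star x$ for all $x,y\in\mathfrak{g}$. Here $\mathfrak{f}_4$ is the exceptional simple complex Lie algebra of type $F_4$ (of dimension $52$). *)

theory Defs
  imports Complex_Main
begin

definition bilinear_product :: "('k::field \<Rightarrow> 'a::ab_group_add \<Rightarrow> 'a) \<Rightarrow> ('a \<Rightarrow> 'a \<Rightarrow> 'a) \<Rightarrow> bool"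
  where "bilinear_product scale m \<longleftrightarrow>
    (\<forall>x. Vector_Spaces.linear scale scale (m x)) \<and>
    (\<forall>y. Vector_Spaces.linear scale scale (\<lambda>x. m x y))"

locale lie_algebra = vector_space scale
  for scale :: "'k::field \<Rightarrow> 'a::ab_group_add \<Rightarrow> 'a" +
  fixes bracket :: "'a \<Rightarrow> 'a \<Rightarrow> 'a"
  assumes bracket_bilinear: "bilinear_product scale bracket"
    and bracket_self: "bracket x x = 0"
    and jacobi: "bracket x (bracket y z) + bracket y (bracket z x) + bracket z (bracket x y) = 0"
begin

definition ideal :: "'a set \<Rightarrow> bool"
  where "ideal I \<longleftrightarrow> subspace I \<and> (\<forall>x. \<forall>y\<in>I. bracket x y \<in> I)"

end

locale simple_lie_algebra = lie_algebra +
  assumes non_abelian: "\<exists>x y. bracket x y \<noteq> 0"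
    and ideal_trivial: "ideal I \<Longrightarrow> I = {0} \<or> I = UNIV"

definition lie_isomorphic ::
  "('k::field \<Rightarrow> 'a::ab_group_add \<Rightarrow> 'a) \<Rightarrow> ('a \<Rightarrow> 'a \<Rightarrow> 'a) \<Rightarrow>
   ('k \<Rightarrow> 'b::ab_group_add \<Rightarrow> 'b) \<Rightarrow> ('b \<Rightarrow> 'b \<Rightarrow> 'b) \<Rightarrow> bool"
  where "lie_isomorphic scale1 bracket1 scale2 bracket2 \<longleftrightarrow>
    (\<exists>\<phi>. Vector_Spaces.linear scale1 scale2 \<phi> \<and> bij \<phi> \<and>
      (\<forall>x y. \<phi> (bracket1 x y) = bracket2 (\<phi> x) (\<phi> y)))"

definition prelie_product :: "('k::field \<Rightarrow> 'a::ab_group_add \<Rightarrow> 'a) \<Rightarrow> ('a \<Rightarrow> 'a \<Rightarrow> 'a) \<Rightarrow> bool"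
  where "prelie_product scale star \<longleftrightarrow> bilinear_product scale star \<and>
    (\<forall>x y z. star (star x y) z - star x (star y z) = star (star y x) z - star y (star x z))"

definition induces_bracket :: "('a::ab_group_add \<Rightarrow> 'a \<Rightarrow> 'a) \<Rightarrow> ('a \<Rightarrow> 'a \<Rightarrow> 'a) \<Rightarrow> bool"
  where "induces_bracket star bracket \<longleftrightarrow> (\<forall>x y. bracket x y = star x y - star y x)"

definition is_prelie :: "('k::field \<Rightarrow> 'a::ab_group_add \<Rightarrow> 'a) \<Rightarrow> ('a \<Rightarrow> 'a \<Rightarrow> 'a) \<Rightarrow> bool"
  where "is_prelie scale bracket \<longleftrightarrow>
    (\<exists>star. prelie_product scale star \<and> induces_bracket star bracket)"


text \<open>
  The Lie algebra $\mathfrak{f}_4$ is given by its Serre presentation: generators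
  $e_i, f_i, h_i$ for the nodes $i$ of the Dynkin diagram, subject to the Serre relations of
  the Cartan matrix.  The quotient is taken on formal terms: \<open>serre_eq A\<close> is the
  least congruence that contains the axioms of a complex vector space, the axioms of a Lie
  bracket and the Serre relations of \<open>A\<close>, where
  $A_{ij} = \langle \alpha_i^\vee, \alpha_j \rangle$.
\<close>

datatype 'i serre_term =
    Gen_E 'i | Gen_F 'i | Gen_H 'i
  | Zero
  | Add "'i serre_term" "'i serre_term"
  | Scale complex "'i serre_term"
  | Br "'i serre_term" "'i serre_term"

inductive serre_eq :: "('i \<Rightarrow> 'i \<Rightarrow> int) \<Rightarrow> 'i serre_term \<Rightarrow> 'i serre_term \<Rightarrow> bool"
  for A :: "'i \<Rightarrow> 'i \<Rightarrow> int"
where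
  serre_refl: "serre_eq A x x"
| serre_sym: "serre_eq A x y \<Longrightarrow> serre_eq A y x"
| serre_trans: "serre_eq A x y \<Longrightarrow> serre_eq A y z \<Longrightarrow> serre_eq A x z"
| serre_cong_add: "serre_eq A x x' \<Longrightarrow> serre_eq A y y' \<Longrightarrow> serre_eq A (Add x y) (Add x' y')"
| serre_cong_scale: "serre_eq A x x' \<Longrightarrow> serre_eq A (Scale c x) (Scale c x')"
| serre_cong_br: "serre_eq A x x' \<Longrightarrow> serre_eq A y y' \<Longrightarrow> serre_eq A (Br x y) (Br x' y')"
| serre_add_assoc: "serre_eq A (Add (Add x y) z) (Add x (Add y z))"
| serre_add_commute: "serre_eq A (Add x y) (Add y x)"
| serre_add_zero: "serre_eq A (Add Zero x) x"
| serre_add_inverse: "serre_eq A (Add (Scale (- 1) x) x) Zero"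
| serre_scale_add_right: "serre_eq A (Scale c (Add x y)) (Add (Scale c x) (Scale c y))"
| serre_scale_add_left: "serre_eq A (Scale (c + d) x) (Add (Scale c x) (Scale d x))"
| serre_scale_scale: "serre_eq A (Scale c (Scale d x)) (Scale (c * d) x)"
| serre_scale_one: "serre_eq A (Scale 1 x) x"
| serre_br_add_left: "serre_eq A (Br (Add x y) z) (Add (Br x z) (Br y z))"
| serre_br_add_right: "serre_eq A (Br z (Add x y)) (Add (Br z x) (Br z y))"
| serre_br_scale_left: "serre_eq A (Br (Scale c x) y) (Scale c (Br x y))"
| serre_br_scale_right: "serre_eq A (Br x (Scale c y)) (Scale c (Br x y))"
| serre_br_self: "serre_eq A (Br x x) Zero"
| serre_br_jacobi: "serre_eq A (Add (Add (Br x (Br y z)) (Br y (Br z x))) (Br z (Br x y))) Zero"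
| serre_H_H: "serre_eq A (Br (Gen_H i) (Gen_H j)) Zero"
| serre_E_F_same: "serre_eq A (Br (Gen_E i) (Gen_F i)) (Gen_H i)"
| serre_E_F_distinct: "i \<noteq> j \<Longrightarrow> serre_eq A (Br (Gen_E i) (Gen_F j)) Zero"
| serre_H_E: "serre_eq A (Br (Gen_H i) (Gen_E j)) (Scale (of_int (A i j)) (Gen_E j))"
| serre_H_F: "serre_eq A (Br (Gen_H i) (Gen_F j)) (Scale (- of_int (A i j)) (Gen_F j))"
| serre_E_E: "i \<noteq> j \<Longrightarrow> serre_eq A ((Br (Gen_E i) ^^ nat (1 - A i j)) (Gen_E j)) Zero"
| serre_F_F: "i \<noteq> j \<Longrightarrow> serre_eq A ((Br (Gen_F i) ^^ nat (1 - A i j)) (Gen_F j)) Zero"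

lemma equivp_serre_eq: "equivp (serre_eq A)"
  by (intro equivpI reflpI sympI transpI) (blast intro: serre_eq.intros)+

text \<open>
  Nodes of the Dynkin diagram $\alpha_1 - \alpha_2 \Rightarrow \alpha_3 - \alpha_4$ of type $F_4$,
  with $\alpha_1, \alpha_2$ long.
\<close>

datatype f4_node = N1 | N2 | N3 | N4

fun cartan_F4 :: "f4_node \<Rightarrow> f4_node \<Rightarrow> int" where
  "cartan_F4 N1 N1 = 2"  | "cartan_F4 N1 N2 = -1" | "cartan_F4 N1 N3 = 0"  | "cartan_F4 N1 N4 = 0"
| "cartan_F4 N2 N1 = -1" | "cartan_F4 N2 N2 = 2"  | "cartan_F4 N2 N3 = -1" | "cartan_F4 N2 N4 = 0"
| "cartan_F4 N3 N1 = 0"  | "cartan_F4 N3 N2 = -2" | "cartan_F4 N3 N3 = 2"  | "cartan_F4 N3 N4 = -1"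
| "cartan_F4 N4 N1 = 0"  | "cartan_F4 N4 N2 = 0"  | "cartan_F4 N4 N3 = -1" | "cartan_F4 N4 N4 = 2"

quotient_type f4 = "f4_node serre_term" / "serre_eq cartan_F4"
  by (rule equivp_serre_eq)

instantiation f4 :: ab_group_add
begin

lift_definition zero_f4 :: f4 is Zero .

lift_definition plus_f4 :: "f4 \<Rightarrow> f4 \<Rightarrow> f4" is Add
  by (rule serre_cong_add)

lift_definition uminus_f4 :: "f4 \<Rightarrow> f4" is "Scale (- 1)"
  by (rule serre_cong_scale)

definition minus_f4 :: "f4 \<Rightarrow> f4 \<Rightarrow> f4"
  where "minus_f4 x y = x + (- y)"

instance
proof
  fix x y z :: f4
  show "x + y + z = x + (y + z)" by transfer (rule serre_add_assoc)
  show "x + y = y + x" by transfer (rule serre_add_commute)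
  show "0 + x = x" by transfer (rule serre_add_zero)
  show "- x + x = 0" by transfer (rule serre_add_inverse)
  show "x - y = x + (- y)" by (rule minus_f4_def)
qed

end

lift_definition f4_scale :: "complex \<Rightarrow> f4 \<Rightarrow> f4" is Scale
  by (rule serre_cong_scale)

lift_definition f4_bracket :: "f4 \<Rightarrow> f4 \<Rightarrow> f4" is Br
  by (rule serre_cong_br)

lemma vector_space_f4: "vector_space f4_scale"
  by unfold_locales
    (transfer, rule serre_scale_add_right serre_scale_add_left serre_scale_scale serre_scale_one)+

lemma bilinear_product_f4: "bilinear_product f4_scale f4_bracket"
proof -
  interpret vector_space f4_scale by (rule vector_space_f4)
  show ?thesis
    unfolding bilinear_product_def
    by (intro conjI allI; unfold_locales;
        transfer, rule serre_br_add_left serre_br_add_right serre_br_scale_left serre_br_scale_right)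
qed

lemma lie_algebra_f4: "lie_algebra f4_scale f4_bracket"
proof -
  interpret vector_space f4_scale by (rule vector_space_f4)
  show ?thesis
    by (unfold_locales; (rule bilinear_product_f4)?; transfer; rule serre_br_self serre_br_jacobi)
qed

end

theory Submission
  imports Defs "HOL-Computational_Algebra.Fundamental_Theorem_Algebra"
begin

text \<open>
  Let \<open>x \<star> y\<close> be a prelie product inducing the bracket. The prelie identity says that the left
  multiplications form a representation \<open>L\<close> for which the identity map is a cocycle. If the
  invariant form \<open>tr (L\<^sub>x L\<^sub>y)\<close> is nondegenerate, its Casimir operator
  \<open>C = \<Sum> L\<^sub>b L\<^sub>d\<close>, summed over dual bases, equals the right multiplication by
  \<open>e = \<Sum> b \<star> d\<close>. This has trace \<open>0\<close>, being the difference of \<open>L\<^sub>e\<close> and \<open>ad e\<close>, which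
  have trace \<open>0\<close> because the Lie algebra is perfect; but \<open>tr C\<close> is the dimension.

  Otherwise the form vanishes by simplicity. As in the proof of Cartan's criterion, every \<open>L\<^sub>x\<close> is
  then nilpotent: with \<open>S\<close> the complex conjugate of the semisimple part of \<open>L\<^sub>x\<close>, the commutator
  of \<open>S\<close> with \<open>L\<^sub>b\<close> is a combination of left multiplications, so \<open>tr (L\<^sub>y S) = 0\<close> for all
  \<open>y\<close>, and \<open>tr (L\<^sub>x S)\<close> is the sum of the squared absolute values of the eigenvalues. By
  Engel's theorem all sufficiently long products of left multiplications vanish, which contradicts
  perfectness.
\<close>

subsection \<open>Linear operators and generalized eigenspaces\<close>

locale operator_space = vector_space scale
  for scale :: "'a::field \<Rightarrow> 'b::ab_group_add \<Rightarrow> 'b" (infixr "*s" 75)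
begin

abbreviation endo :: "('b \<Rightarrow> 'b) \<Rightarrow> bool"
  where "endo T \<equiv> Vector_Spaces.linear scale scale T"

lemma endoI:
  assumes "\<And>x y. T (x + y) = T x + T y" "\<And>c x. T (c *s x) = c *s T x"
  shows "endo T"
  using assms by unfold_locales

lemma endo_add: "endo T \<Longrightarrow> T (x + y) = T x + T y"
  and endo_scale: "endo T \<Longrightarrow> T (c *s x) = c *s T x"
  and endo_diff: "endo T \<Longrightarrow> T (x - y) = T x - T y"
  and endo_zero: "endo T \<Longrightarrow> T 0 = 0"
  and endo_sum: "endo T \<Longrightarrow> T (\<Sum>i\<in>I. f i) = (\<Sum>i\<in>I. T (f i))"
  by (simp_all add: linear_iff_module_hom module_hom.add module_hom.scale module_hom.diff
      module_hom.zero module_hom.sum)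

lemmas endo_simps = endo_add endo_scale endo_diff endo_zero endo_sum

lemma endo_eq_on_span:
  assumes "endo S" "endo T" "\<And>v. v \<in> A \<Longrightarrow> S v = T v" "v \<in> span A"
  shows "S v = T v"
  using assms(4)
  by (induction rule: span_induct_alt) (simp_all add: assms(3) endo_simps[OF assms(1)] endo_simps[OF assms(2)])

lemma endo_funpow: "endo T \<Longrightarrow> endo (T ^^ k)"
  by (induction k) (auto intro!: endoI simp: endo_simps)

lemma funpow_commute: "(T ^^ k) (T v) = T ((T ^^ k) v)"
  by (simp add: funpow_swap1)

section \<open>Generalized eigenspaces\<close>

definition shift :: "('b \<Rightarrow> 'b) \<Rightarrow> 'a \<Rightarrow> 'b \<Rightarrow> 'b"
  where "shift T \<mu> v = T v - \<mu> *s v"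

lemma shift_zero: "shift T 0 = T"
  by (simp add: shift_def fun_eq_iff)

lemma endo_shift: "endo T \<Longrightarrow> endo (shift T \<mu>)"
  by (intro endoI) (simp_all add: shift_def endo_simps algebra_simps)

lemma funpow_add_apply: "(f ^^ (m + n)) v = (f ^^ m) ((f ^^ n) v)"
  by (simp add: funpow_add)

lemma funpow_endo_mono:
  assumes "endo T" "(T ^^ k) v = 0" "k \<le> l" shows "(T ^^ l) v = 0"
proof -
  have "(T ^^ (l - k + k)) v = 0"
    unfolding funpow_add_apply assms(2) using endo_zero[OF endo_funpow[OF assms(1)]] by simp
  with assms(3) show ?thesis by simp
qed

definition gen_eigenspace :: "('b \<Rightarrow> 'b) \<Rightarrow> 'a \<Rightarrow> 'b set"
  where "gen_eigenspace T \<mu> = {v. \<exists>k. (shift T \<mu> ^^ k) v = 0}"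

lemma subspace_gen_eigenspace:
  assumes "endo T" shows "subspace (gen_eigenspace T \<mu>)"
proof (intro subspaceI)
  note e = endo_shift[OF assms, of \<mu>]
  note E = endo_funpow[OF e]
  show "0 \<in> gen_eigenspace T \<mu>"
    by (auto simp: gen_eigenspace_def intro!: exI[of _ 0])
  fix x y assume "x \<in> gen_eigenspace T \<mu>" "y \<in> gen_eigenspace T \<mu>"
  then obtain k l where "(shift T \<mu> ^^ k) x = 0" "(shift T \<mu> ^^ l) y = 0"
    by (auto simp: gen_eigenspace_def)
  then have "(shift T \<mu> ^^ max k l) x = 0" "(shift T \<mu> ^^ max k l) y = 0"
    using funpow_endo_mono[OF e] by (meson max.cobounded1 max.cobounded2)+
  then show "x + y \<in> gen_eigenspace T \<mu>"
    using endo_add[OF E] by (auto simp: gen_eigenspace_def intro!: exI[of _ "max k l"])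
next
  fix c x assume "x \<in> gen_eigenspace T \<mu>"
  then show "c *s x \<in> gen_eigenspace T \<mu>"
    using endo_scale[OF endo_funpow[OF endo_shift[OF assms, of \<mu>]]]
    by (auto simp: gen_eigenspace_def)
qed

lemma gen_eigenspace_shift_iff:
  "shift T \<mu> v \<in> gen_eigenspace T \<mu> \<longleftrightarrow> v \<in> gen_eigenspace T \<mu>" if "endo T"
proof
  assume "shift T \<mu> v \<in> gen_eigenspace T \<mu>"
  then obtain k where "(shift T \<mu> ^^ k) (shift T \<mu> v) = 0"
    by (auto simp: gen_eigenspace_def)
  then have "(shift T \<mu> ^^ Suc k) v = 0" by (simp add: funpow_swap1)
  then show "v \<in> gen_eigenspace T \<mu>" unfolding gen_eigenspace_def by blast
next
  assume "v \<in> gen_eigenspace T \<mu>"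
  then obtain k where "(shift T \<mu> ^^ k) v = 0" by (auto simp: gen_eigenspace_def)
  then have "(shift T \<mu> ^^ k) (shift T \<mu> v) = 0"
    by (simp add: funpow_commute endo_zero[OF endo_shift[OF that]])
  then show "shift T \<mu> v \<in> gen_eigenspace T \<mu>" unfolding gen_eigenspace_def by blast
qed

lemma gen_eigenspace_shift:
  assumes "endo T" "v \<in> gen_eigenspace T \<mu>" shows "shift T \<nu> v \<in> gen_eigenspace T \<mu>"
proof -
  have "shift T \<nu> v = shift T \<mu> v + (\<mu> - \<nu>) *s v"
    by (simp add: shift_def algebra_simps)
  then show ?thesis
    using assms subspace_add[OF subspace_gen_eigenspace[OF assms(1)]]
      subspace_scale[OF subspace_gen_eigenspace[OF assms(1)]]
    by (simp add: gen_eigenspace_shift_iff)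
qed

lemma gen_eigenspace_shift_funpow:
  assumes "endo T" "v \<in> gen_eigenspace T \<mu>" shows "(shift T \<nu> ^^ k) v \<in> gen_eigenspace T \<mu>"
  using assms by (induction k) (auto intro: gen_eigenspace_shift)

text \<open>On the kernel of \<open>shift T \<nu>\<close> the operator \<open>shift T \<mu>\<close>
  is the nonzero scalar \<open>\<nu> - \<mu>\<close>, so no power of it can kill a nonzero
  \<open>v\<close>.\<close>

lemma shift_inj_gen_eigenspace:
  assumes T: "endo T" and v: "v \<in> gen_eigenspace T \<mu>" and "\<nu> \<noteq> \<mu>" and z: "shift T \<nu> v = 0"
  shows "v = 0"
proof -
  from v obtain k where k: "(shift T \<mu> ^^ k) v = 0" by (auto simp: gen_eigenspace_def)
  have 1: "shift T \<mu> v = (\<nu> - \<mu>) *s v"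
    using z by (simp add: shift_def algebra_simps)
  have "(shift T \<mu> ^^ j) v = (\<nu> - \<mu>) ^ j *s v" for j
    by (induction j) (simp_all add: endo_scale[OF endo_shift[OF T]] 1 mult.commute)
  with k \<open>\<nu> \<noteq> \<mu>\<close> show ?thesis by simp
qed

text \<open>The operator \<open>shift T \<nu>\<close> is the nonzero scalar
  \<open>\<mu> - \<nu>\<close> plus \<open>shift T \<mu>\<close>. Inverting it goes by induction on
  the power of \<open>shift T \<mu>\<close> that kills \<open>v\<close>:
  \<open>shift T \<mu> v\<close> is killed by a smaller power and hence already has a
  preimage.\<close>

lemma shift_surj_gen_eigenspace:
  assumes T: "endo T" and v: "v \<in> gen_eigenspace T \<mu>" and ne: "\<nu> \<noteq> \<mu>"
  shows "\<exists>w\<in>gen_eigenspace T \<mu>. shift T \<nu> w = v"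
proof -
  note sub = subspace_gen_eigenspace[OF T, of \<mu>]
  have "(shift T \<mu> ^^ k) v = 0 \<Longrightarrow> \<exists>w\<in>gen_eigenspace T \<mu>. shift T \<nu> w = v" for k
  proof (induction k arbitrary: v)
    case 0
    then show ?case
      using subspace_0[OF sub] by (auto intro!: bexI[of _ 0] simp: endo_zero[OF endo_shift[OF T]])
  next
    case (Suc k)
    then have "(shift T \<mu> ^^ k) (shift T \<mu> v) = 0" by (simp add: funpow_swap1)
    from Suc.IH[OF this] obtain u where u: "u \<in> gen_eigenspace T \<mu>" "shift T \<nu> u = shift T \<mu> v"
      by blast
    have v: "v \<in> gen_eigenspace T \<mu>" using Suc.prems unfolding gen_eigenspace_def by blast
    define w where "w = inverse (\<mu> - \<nu>) *s (v - u)"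
    have "shift T \<nu> w = inverse (\<mu> - \<nu>) *s (shift T \<nu> v - shift T \<mu> v)"
      by (simp add: w_def endo_simps[OF endo_shift[OF T]] u)
    also have "shift T \<nu> v - shift T \<mu> v = (\<mu> - \<nu>) *s v"
      by (simp add: shift_def algebra_simps)
    finally have "shift T \<nu> w = v" using ne by simp
    moreover have "w \<in> gen_eigenspace T \<mu>"
      unfolding w_def using sub u v by (intro subspace_scale subspace_diff)
    ultimately show ?case by blast
  qed
  then show ?thesis using v by (auto simp: gen_eigenspace_def)
qed

text \<open>A power of \<open>shift T \<nu>\<close> removes the summand for \<open>\<nu>\<close> and
  is injective on the other generalized eigenspaces, which reduces the relation to a smaller
  set.\<close>

lemma gen_eigenspace_independent:
  assumes T: "endo T" and "finite F" "\<And>\<mu>. \<mu> \<in> F \<Longrightarrow> u \<mu> \<in> gen_eigenspace T \<mu>"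
    and "(\<Sum>\<mu>\<in>F. u \<mu>) = 0" "\<mu> \<in> F"
  shows "u \<mu> = 0"
proof -
  have "\<forall>\<mu>\<in>F. u \<mu> = 0"
    using assms(2-4)
  proof (induction F arbitrary: u rule: finite_induct)
    case (insert \<nu> F)
    obtain k where k: "(shift T \<nu> ^^ k) (u \<nu>) = 0"
      using insert.prems(1)[of \<nu>] by (auto simp: gen_eigenspace_def)
    note E = endo_funpow[OF endo_shift[OF T]]
    have inj: "(shift T \<nu> ^^ j) w = 0 \<Longrightarrow> w \<in> gen_eigenspace T \<mu> \<Longrightarrow> \<nu> \<noteq> \<mu> \<Longrightarrow> w = 0" for j w \<mu>
      by (induction j)
        (auto dest: shift_inj_gen_eigenspace[OF T, of "(shift T \<nu> ^^ j) w" \<mu> \<nu> for j]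
          gen_eigenspace_shift_funpow[OF T])
    have "(shift T \<nu> ^^ k) (\<Sum>\<mu>\<in>insert \<nu> F. u \<mu>) = 0"
      by (simp only: insert.prems(2) endo_zero[OF E])
    then have "(\<Sum>\<mu>\<in>F. (shift T \<nu> ^^ k) (u \<mu>)) = 0"
      using insert.hyps k by (simp add: endo_simps[OF E])
    then have "\<forall>\<mu>\<in>F. (shift T \<nu> ^^ k) (u \<mu>) = 0"
      by (intro insert.IH) (auto intro: gen_eigenspace_shift_funpow[OF T] insert.prems)
    then have F: "u \<mu> = 0" if "\<mu> \<in> F" for \<mu>
      using that insert.prems(1)[of \<mu>] insert.hyps(2) inj[of k "u \<mu>" \<mu>] by auto
    then have "u \<nu> = 0" using insert.prems(2) insert.hyps by simp
    with F show ?case by blast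
  qed auto
  with assms(5) show ?thesis by blast
qed

section \<open>Evaluation of a polynomial at an operator, by Horner's scheme\<close>

definition poly_endo :: "'a poly \<Rightarrow> ('b \<Rightarrow> 'b) \<Rightarrow> 'b \<Rightarrow> 'b"
  where "poly_endo p T = fold_coeffs (\<lambda>a f v. a *s v + T (f v)) p (\<lambda>_. 0)"

lemma poly_endo_0: "poly_endo 0 T v = 0"
  by (simp add: poly_endo_def)

lemma poly_endo_pCons:
  assumes "endo T" shows "poly_endo (pCons a p) T v = a *s v + T (poly_endo p T v)"
  by (cases "p = 0 \<and> a = 0") (auto simp: poly_endo_def endo_zero[OF assms])

lemma endo_poly_endo: "endo T \<Longrightarrow> endo (poly_endo p T)"
  by (intro endoI; induction p)
     (simp_all add: poly_endo_0 poly_endo_pCons endo_simps algebra_simps)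

lemma poly_endo_add:
  "endo T \<Longrightarrow> poly_endo (p + q) T v = poly_endo p T v + poly_endo q T v"
  by (induction p q rule: poly_induct2) (simp_all add: poly_endo_0 poly_endo_pCons endo_simps algebra_simps)

lemma poly_endo_smult: "endo T \<Longrightarrow> poly_endo (smult c p) T v = c *s poly_endo p T v"
  by (induction p) (simp_all add: poly_endo_0 poly_endo_pCons endo_simps algebra_simps)

lemma poly_endo_commute: "endo T \<Longrightarrow> poly_endo p T (T v) = T (poly_endo p T v)"
  by (induction p) (simp_all add: poly_endo_0 poly_endo_pCons endo_simps)

text \<open>Splits off a root in inductions on the degree: if the product kills \<open>v\<close>,
  then the cofactor \<open>p\<close> kills \<open>shift T c v\<close>.\<close>

lemma poly_endo_linear_factor:
  assumes T: "endo T" shows "poly_endo ([:- c, 1:] * p) T v = poly_endo p T (shift T c v)"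
proof -
  have "[:- c, 1:] * p = smult (- c) p + pCons 0 p" by simp
  then have "poly_endo ([:- c, 1:] * p) T v = T (poly_endo p T v) - c *s poly_endo p T v"
    by (simp only: poly_endo_add[OF T] poly_endo_smult[OF T] poly_endo_pCons[OF T]) simp
  also have "\<dots> = poly_endo p T (shift T c v)"
    by (simp add: shift_def endo_simps[OF endo_poly_endo[OF T]] poly_endo_commute[OF T])
  finally show ?thesis .
qed

lemma poly_endo_monom: "endo T \<Longrightarrow> poly_endo (monom c k) T v = c *s (T ^^ k) v"
  by (induction k) (simp_all add: monom_0 monom_Suc poly_endo_0 poly_endo_pCons endo_simps)

lemma poly_endo_sum:
  "endo T \<Longrightarrow> poly_endo (\<Sum>i\<in>I. f i) T v = (\<Sum>i\<in>I. poly_endo (f i) T v)"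
  by (induction I rule: infinite_finite_induct) (simp_all add: poly_endo_0 poly_endo_add)

lemma span_image_lessThanD:
  "x \<in> span (f ` {..<k::nat}) \<Longrightarrow> \<exists>a. x = (\<Sum>i<k. a i *s f i)"
proof (induction k arbitrary: x)
  case (Suc k)
  then obtain c where "x - c *s f k \<in> span (f ` {..<k})"
    by (auto simp: lessThan_Suc span_breakdown_eq)
  from Suc.IH[OF this] obtain a where a: "x - c *s f k = (\<Sum>i<k. a i *s f i)" by blast
  have "(\<Sum>i<k. (a(k := c)) i *s f i) = (\<Sum>i<k. a i *s f i)"
    by (intro sum.cong) auto
  with a have "x = (\<Sum>i<Suc k. (a(k := c)) i *s f i)"
    by (simp add: algebra_simps)
  then show ?case by blast
qed simp

end

subsection \<open>The trace\<close>

locale fin_dim_operator_space = operator_space scale + finite_dimensional_vector_space scale Basis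
  for scale :: "'a::field \<Rightarrow> 'b::ab_group_add \<Rightarrow> 'b" (infixr "*s" 75) and Basis
begin

text \<open>The iterates of \<open>v\<close> cannot all be independent. The first one in the span of
  its predecessors yields a monic polynomial, which may depend on \<open>v\<close>.\<close>

lemma ex_annihilating_poly:
  assumes T: "endo T" shows "\<exists>p. p \<noteq> 0 \<and> poly_endo p T v = 0"
proof -
  define f where "f i = (T ^^ i) v" for i
  have "\<exists>k. f k \<in> span (f ` {..<k})"
  proof (rule ccontr)
    assume "\<nexists>k. f k \<in> span (f ` {..<k})"
    then have n: "f k \<notin> span (f ` {..<k})" for k by simp
    have "independent (f ` {..<k}) \<and> card (f ` {..<k}) = k" for k
    proof (induction k)
      case (Suc k)
      have "f k \<notin> f ` {..<k}" by (rule contra_subsetD[OF span_superset n])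
      moreover have "f ` {..<Suc k} = insert (f k) (f ` {..<k})" by (auto simp: lessThan_Suc)
      moreover have "independent (insert (f k) (f ` {..<k}))"
        using independent_insertI[OF n] Suc.IH by blast
      ultimately show ?case using Suc.IH by (metis card_insert_disjoint finite_imageI finite_lessThan)
    qed (use independent_empty in auto)
    from this[of "Suc (dim UNIV)"] show False
      using independent_card_le_dim[of "f ` {..<Suc (dim UNIV)}" UNIV] by auto
  qed
  then obtain k a where a: "f k = (\<Sum>i<k. a i *s f i)" using span_image_lessThanD by blast
  define p where "p = monom 1 k + (\<Sum>i<k. monom (- a i) i)"
  have "coeff p k = 1" by (simp add: p_def coeff_sum)
  then have "p \<noteq> 0" by auto
  moreover have "poly_endo p T v = 0"
    using a by (simp add: p_def poly_endo_add[OF T] poly_endo_monom[OF T] poly_endo_sum[OF T]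
        f_def sum_negf)
  ultimately show ?thesis by blast
qed

definition trace :: "('b \<Rightarrow> 'b) \<Rightarrow> 'a"
  where "trace T = (\<Sum>b\<in>Basis. representation Basis (T b) b)"

lemma sum_representation:
  "independent B \<Longrightarrow> span B = UNIV \<Longrightarrow> (\<Sum>b\<in>B. representation B v b *s b) = v"
  using sum_representation_eq[of B v B] finiteI_independent by simp

text \<open>Matrix-vector multiplication for arbitrary bases of source and target. For the identity
  map it is the change of basis.\<close>

lemma representation_endo:
  assumes T: "endo T" and B: "independent B" "span B = UNIV"
    and C: "independent C" "span C = UNIV"
  shows "representation C (T v) c = (\<Sum>b\<in>B. representation B v b * representation C (T b) c)"
proof -
  have "T v = (\<Sum>b\<in>B. representation B v b *s T b)"
    by (subst (1) sum_representation[OF B, symmetric]) (simp add: endo_simps[OF T])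
  then show ?thesis
    by (simp add: representation_sum[OF C(1)] representation_scale[OF C(1)] C(2))
qed

lemmas Basis_basis = independent_Basis span_Basis

lemma trace_basis:
  assumes T: "endo T" and B: "independent B" "span B = UNIV"
  shows "trace T = (\<Sum>b\<in>B. representation B (T b) b)"
proof -
  have id: "endo (\<lambda>v. v)" by (intro endoI) auto
  have "trace T = (\<Sum>b\<in>Basis. \<Sum>c\<in>B. representation B (T b) c * representation Basis c b)"
    unfolding trace_def by (intro sum.cong refl representation_endo[OF id B Basis_basis])
  also have "\<dots> = (\<Sum>c\<in>B. \<Sum>b\<in>Basis. representation Basis c b * representation B (T b) c)"
    by (subst sum.swap) (simp add: mult.commute)
  also have "\<dots> = (\<Sum>c\<in>B. representation B (T c) c)"
    by (intro sum.cong refl representation_endo[OF T Basis_basis B, symmetric])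
  finally show ?thesis .
qed

lemma trace_commute:
  assumes "endo S" "endo T" shows "trace (\<lambda>v. S (T v)) = trace (\<lambda>v. T (S v))"
proof -
  have "trace (\<lambda>v. S (T v)) = (\<Sum>b\<in>Basis. \<Sum>c\<in>Basis.
      representation Basis (T b) c * representation Basis (S c) b)"
    unfolding trace_def
    by (intro sum.cong refl representation_endo[OF assms(1) Basis_basis Basis_basis])
  also have "\<dots> = (\<Sum>c\<in>Basis. \<Sum>b\<in>Basis.
      representation Basis (S c) b * representation Basis (T b) c)"
    by (subst sum.swap) (simp add: mult.commute)
  also have "\<dots> = trace (\<lambda>v. T (S v))"
    unfolding trace_def
    by (intro sum.cong refl representation_endo[OF assms(2) Basis_basis Basis_basis, symmetric])
  finally show ?thesis .
qed

lemma trace_add: "trace (\<lambda>v. S v + T v) = trace S + trace T"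
  by (simp add: trace_def representation_add[OF independent_Basis] span_Basis sum.distrib)

lemma trace_diff: "trace (\<lambda>v. S v - T v) = trace S - trace T"
  by (simp add: trace_def representation_diff[OF independent_Basis] span_Basis sum_subtractf)

lemma trace_scale: "trace (\<lambda>v. c *s T v) = c * trace T"
  by (simp add: trace_def representation_scale[OF independent_Basis] span_Basis sum_distrib_left)

lemma trace_zero: "trace (\<lambda>v. 0) = 0"
  by (simp add: trace_def representation_zero)

lemma trace_sum: "trace (\<lambda>v. \<Sum>i\<in>I. f i v) = (\<Sum>i\<in>I. trace (f i))"
  by (induction I rule: infinite_finite_induct) (simp_all add: trace_zero trace_add)

text \<open>An independent set of maximal size with \<open>N\<close>-invariant span and zero
  diagonal entries is a basis: otherwise the last iterate \<open>w\<close> of an outside vector that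
  is still outside the span could be added, because \<open>N w\<close> lies in the span and has no
  \<open>w\<close>-coordinate.\<close>

lemma trace_locally_nilpotent:
  assumes N: "endo N" and nil: "\<And>v. \<exists>k. (N ^^ k) v = 0"
  shows "trace N = 0"
proof -
  define P where "P A \<longleftrightarrow> independent A \<and> (\<forall>a\<in>A. N a \<in> span A \<and> representation A (N a) a = 0)"
    for A
  have "P {}" by (simp add: P_def independent_empty)
  moreover have "\<forall>A. P A \<longrightarrow> card A < Suc (dim UNIV)"
    using independent_card_le_dim[OF subset_UNIV] by (simp add: P_def less_Suc_eq_le)
  ultimately obtain A where A: "P A" and max: "\<And>A'. P A' \<Longrightarrow> card A' \<le> card A"
    using ex_has_greatest_nat[of P "{}" card] by blast
  then have indA: "independent A" by (simp add: P_def)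
  have "span A = UNIV"
  proof (rule ccontr)
    assume "span A \<noteq> UNIV"
    then obtain v where v: "v \<notin> span A" by blast
    obtain l where "(N ^^ l) v = 0" using nil by blast
    then have ex: "(N ^^ l) v \<in> span A" by (simp add: span_zero)
    define k where "k = (LEAST k. (N ^^ k) v \<in> span A)"
    have k: "(N ^^ k) v \<in> span A" unfolding k_def using ex by (rule LeastI)
    with v obtain j where j: "k = Suc j" by (cases k) auto
    define w where "w = (N ^^ j) v"
    have w: "w \<notin> span A" unfolding w_def by (rule not_less_Least) (use j in \<open>simp add: k_def\<close>)
    have Nw: "N w \<in> span A" using k by (simp add: w_def j)
    have ind: "independent (insert w A)" using indA w by (simp add: independent_insert)
    have "w \<notin> A" using w span_base by blast
    have ext: "representation (insert w A) u = representation A u" if "u \<in> span A" for u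
      using representation_extend[OF ind that] by blast
    have "representation A (N w) w = 0"
      using representation_ne_zero \<open>w \<notin> A\<close> by blast
    then have "P (insert w A)"
      using A Nw span_mono[of A "insert w A"] by (auto simp: P_def ind ext)
    from max[OF this] show False
      using \<open>w \<notin> A\<close> finiteI_independent[OF indA] by simp
  qed
  then show ?thesis using trace_basis[OF N indA] A by (simp add: P_def)
qed

end

subsection \<open>Complex operators\<close>

locale fin_dim_complex_operator_space = fin_dim_operator_space scale Basis
  for scale :: "complex \<Rightarrow> 'a::ab_group_add \<Rightarrow> 'a" (infixr "*s" 75) and Basis
begin

text \<open>Induction on the degree of a polynomial that annihilates \<open>v\<close>. After a root
  \<open>\<mu>\<close> is split off, \<open>shift T \<mu> v\<close> lies in the span; it agrees with
  \<open>shift T \<mu> w\<close> for some \<open>w\<close> in the span up to a generalized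
  eigenvector for \<open>\<mu>\<close>, and then so do \<open>v\<close> and
  \<open>w\<close>.\<close>

lemma span_gen_eigenspaces:
  assumes T: "endo T" shows "span (\<Union>\<mu>. gen_eigenspace T \<mu>) = UNIV"
proof -
  let ?U = "span (\<Union>\<mu>. gen_eigenspace T \<mu>)"
  have gen: "v \<in> ?U" if "v \<in> gen_eigenspace T \<mu>" for v \<mu>
    using that by (intro span_base) auto
  \<comment> \<open>Components for eigenvalues other than \<open>\<mu>\<close> have preimages under
    \<open>shift T \<mu>\<close>; the component for \<open>\<mu>\<close> itself is left as the error
    term, with preimage 0.\<close>
  have solve: "\<exists>w\<in>?U. shift T \<mu> w - u \<in> gen_eigenspace T \<mu>" if "u \<in> ?U" for u \<mu>
    using that
  proof (induction rule: span_induct_alt)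
    case base
    show ?case
      using span_zero subspace_0[OF subspace_gen_eigenspace[OF T]]
      by (auto intro!: bexI[of _ 0] simp: endo_simps[OF endo_shift[OF T]])
  next
    case (step c x y)
    obtain w where w: "w \<in> ?U" "shift T \<mu> w - y \<in> gen_eigenspace T \<mu>" using step by blast
    obtain \<nu> where x: "x \<in> gen_eigenspace T \<nu>" using step by blast
    have "\<exists>z\<in>?U. shift T \<mu> z - x \<in> gen_eigenspace T \<mu>"
    proof (cases "\<mu> = \<nu>")
      case True
      then show ?thesis
        using span_zero x subspace_neg[OF subspace_gen_eigenspace[OF T]]
        by (auto intro!: bexI[of _ 0] simp: endo_simps[OF endo_shift[OF T]])
    next
      case False
      from shift_surj_gen_eigenspace[OF T x False] obtain z
        where "z \<in> gen_eigenspace T \<nu>" "shift T \<mu> z = x" by blast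
      then show ?thesis
        using subspace_0[OF subspace_gen_eigenspace[OF T]] gen by (auto intro!: bexI[of _ z])
    qed
    then obtain z where z: "z \<in> ?U" "shift T \<mu> z - x \<in> gen_eigenspace T \<mu>" by blast
    have "shift T \<mu> (c *s z + w) - (c *s x + y) = c *s (shift T \<mu> z - x) + (shift T \<mu> w - y)"
      by (simp add: endo_simps[OF endo_shift[OF T]] algebra_simps)
    also have "\<dots> \<in> gen_eigenspace T \<mu>"
      using subspace_gen_eigenspace[OF T] w z by (intro subspace_add subspace_scale)
    finally show ?case
      using w(1) z(1) by (intro bexI[of _ "c *s z + w"] span_add span_scale)
  qed
  have "v \<in> ?U" if "p \<noteq> 0" "poly_endo p T v = 0" for p v
    using that
  proof (induction "degree p" arbitrary: p v)
    case 0
    then obtain c where "p = [:c:]" by (metis degree_eq_zeroE)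
    with 0 have "v = 0" by (auto simp: poly_endo_pCons[OF T] poly_endo_0 endo_zero[OF T])
    then show ?case by (simp add: span_zero)
  next
    case (Suc n)
    then have "\<not> constant (poly p)" by (simp add: constant_degree)
    then obtain \<mu> where "poly p \<mu> = 0" using fundamental_theorem_of_algebra by blast
    then obtain q where p: "p = [:- \<mu>, 1:] * q" by (metis dvdE poly_eq_0_iff_dvd)
    with Suc.prems have q: "q \<noteq> 0" by auto
    then have "degree p = Suc (degree q)" unfolding p by (subst degree_mult_eq) auto
    then have "n = degree q" using Suc.hyps(2) by simp
    moreover have "poly_endo q T (shift T \<mu> v) = 0"
      using Suc.prems(2) unfolding p poly_endo_linear_factor[OF T] .
    ultimately have "shift T \<mu> v \<in> ?U" using Suc.hyps(1) q by blast
    from solve[OF this] obtain w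
      where w: "w \<in> ?U" "shift T \<mu> w - shift T \<mu> v \<in> gen_eigenspace T \<mu>" by blast
    then have "w - v \<in> gen_eigenspace T \<mu>"
      by (simp add: endo_diff[OF endo_shift[OF T], symmetric] gen_eigenspace_shift_iff[OF T])
    then have "w - v \<in> ?U" by (rule gen)
    from span_diff[OF w(1) this] show ?case by simp
  qed
  then show ?thesis using ex_annihilating_poly[OF T] by blast
qed

text \<open>
  \<open>S\<close> is the complex conjugate of the semisimple part of \<open>T\<close>; the trace of \<open>T S\<close> is the
  sum of the \<open>\<bar>\<lambda>\<bar>\<^sup>2\<close> over the eigenvalues \<open>\<lambda>\<close> of \<open>T\<close>, with multiplicity.
\<close>

lemma ex_conjugate_semisimple_part:
  assumes T: "endo T"
  obtains S where "endo S" "\<And>\<mu> v. v \<in> gen_eigenspace T \<mu> \<Longrightarrow> S v = cnj \<mu> *s v"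
    "trace (\<lambda>v. T (S v)) = 0 \<Longrightarrow> gen_eigenspace T 0 = UNIV"
proof -
  obtain B where B: "B \<subseteq> (\<Union>\<mu>. gen_eigenspace T \<mu>)" "independent B"
    and le: "(\<Union>\<mu>. gen_eigenspace T \<mu>) \<subseteq> span B"
    using maximal_independent_subset by blast
  have sp: "span B = UNIV"
    using span_minimal[OF le subspace_span] span_gen_eigenspaces[OF T] by auto
  have fin: "finite B" using B finiteI_independent by blast
  \<comment> \<open>\<open>B\<close> is a basis of generalized eigenvectors and \<open>ev\<close>
    picks the eigenvalue of each.\<close>
  define ev where "ev b = (SOME \<mu>. b \<in> gen_eigenspace T \<mu>)" for b
  have ev: "b \<in> gen_eigenspace T (ev b)" if "b \<in> B" for b
    unfolding ev_def using that B by (intro someI_ex[of "\<lambda>\<mu>. b \<in> gen_eigenspace T \<mu>"]) auto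
  let ?r = "representation B"
  note sub = subspace_gen_eigenspace[OF T]
  have rep0: "?r v b = 0" if v: "v \<in> gen_eigenspace T \<mu>" and b: "b \<in> B" "ev b \<noteq> \<mu>" for v \<mu> b
  proof -
    \<comment> \<open>The part of the expansion of \<open>v\<close> at eigenvalue
      \<open>\<nu>\<close>, with \<open>v\<close> itself subtracted at \<open>\<mu>\<close>. These
      vectors sum to 0, so independence of the generalized eigenspaces makes each of them 0.\<close>
    define u where "u \<nu> = (\<Sum>c\<in>{c\<in>B. ev c = \<nu>}. ?r v c *s c) - (if \<nu> = \<mu> then v else 0)" for \<nu>
    let ?F = "insert \<mu> (ev ` B)"
    have "(\<Sum>\<nu>\<in>?F. u \<nu>) = (\<Sum>c\<in>B. ?r v c *s c) - v"
      using fin by (simp add: u_def sum_subtractf sum.group subset_insertI del: sum.insert)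
    then have "(\<Sum>\<nu>\<in>?F. u \<nu>) = 0" by (simp add: sum_representation[OF B(2) sp])
    moreover have "u \<nu> \<in> gen_eigenspace T \<nu>" for \<nu>
      unfolding u_def using v ev subspace_0[OF sub]
      by (intro subspace_diff[OF sub] subspace_sum[OF sub]) (auto intro: subspace_scale[OF sub])
    ultimately have "u (ev b) = 0"
      using gen_eigenspace_independent[OF T, of ?F u "ev b"] fin b by blast
    then have "(\<Sum>c\<in>{c\<in>B. ev c = ev b}. ?r v c *s c) = 0"
      using b by (simp add: u_def)
    then show ?thesis
      using independentD[OF B(2), of "{c\<in>B. ev c = ev b}"] fin b by simp
  qed
  \<comment> \<open>Functional calculus on the semisimple part: \<open>D f\<close> acts on the
    generalized eigenspace for \<open>\<mu>\<close> as the scalar \<open>f \<mu>\<close>.\<close>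
  define D where "D f v = (\<Sum>b\<in>B. ?r v b *s (f (ev b) *s b))" for f v
  have endoD: "endo (D f)" for f
    by (intro endoI)
      (simp_all only: D_def representation_add[OF B(2)] representation_scale[OF B(2)] sp UNIV_I
        scale_left_distrib scale_scale sum.distrib scale_sum_right mult.assoc
        distrib_right)
  have D: "D f v = f \<mu> *s v" if "v \<in> gen_eigenspace T \<mu>" for f v \<mu>
  proof -
    have "D f v = (\<Sum>b\<in>B. f \<mu> *s (?r v b *s b))"
      unfolding D_def by (intro sum.cong refl) (use rep0[OF that] in force)
    also have "\<dots> = f \<mu> *s v"
      by (simp only: scale_sum_right[symmetric] sum_representation[OF B(2) sp])
    finally show ?thesis .
  qed
  let ?S = "D cnj" and ?Q = "D (\<lambda>\<mu>. \<mu> * cnj \<mu>)"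
  \<comment> \<open>On the generalized eigenspace for \<open>\<mu>\<close> this is
    \<open>cnj \<mu>\<close> times \<open>shift T \<mu>\<close>. Hence \<open>N\<close> is locally
    nilpotent and has trace 0, and the trace of \<open>T\<close> after \<open>?S\<close> is that of
    the diagonal operator \<open>?Q\<close>.\<close>
  define N where "N v = T (?S v) - ?Q v" for v
  have endoN: "endo N"
    by (intro endoI) (simp_all add: N_def endo_simps[OF T] endo_simps[OF endoD] algebra_simps)
  have N: "N v = cnj \<mu> *s shift T \<mu> v" if "v \<in> gen_eigenspace T \<mu>" for v \<mu>
    by (simp add: N_def D[OF that] endo_simps[OF T] shift_def algebra_simps)
  have Nk: "(N ^^ k) v = cnj \<mu> ^ k *s (shift T \<mu> ^^ k) v" if v: "v \<in> gen_eigenspace T \<mu>" for v \<mu> k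
    by (induction k)
      (simp_all add: endo_simps[OF endoN] N[OF gen_eigenspace_shift_funpow[OF T v]] mult.commute)
  have "gen_eigenspace T \<mu> \<subseteq> gen_eigenspace N 0" for \<mu>
  proof
    fix v assume v: "v \<in> gen_eigenspace T \<mu>"
    then obtain k where "(shift T \<mu> ^^ k) v = 0" by (auto simp: gen_eigenspace_def)
    with Nk[OF v, of k] show "v \<in> gen_eigenspace N 0"
      by (auto simp: gen_eigenspace_def shift_zero)
  qed
  then have "span (\<Union>\<mu>. gen_eigenspace T \<mu>) \<subseteq> gen_eigenspace N 0"
    by (intro span_minimal subspace_gen_eigenspace endoN) auto
  then have "gen_eigenspace N 0 = UNIV" using span_gen_eigenspaces[OF T] by auto
  then have "trace N = 0"
    by (intro trace_locally_nilpotent endoN) (auto simp: gen_eigenspace_def shift_zero)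
  then have "trace (\<lambda>v. T (?S v)) = trace ?Q"
    using trace_diff[of "\<lambda>v. T (?S v)" ?Q] by (simp add: N_def[abs_def])
  also have "\<dots> = (\<Sum>b\<in>B. ev b * cnj (ev b))"
    unfolding trace_basis[OF endoD B(2) sp]
    by (intro sum.cong refl)
      (simp add: D[OF ev] representation_scale[OF B(2)] sp representation_basis[OF B(2)])
  also have "\<dots> = of_real (\<Sum>b\<in>B. (cmod (ev b))\<^sup>2)"
    by (simp add: complex_norm_square[symmetric])
  finally have tr: "trace (\<lambda>v. T (?S v)) = of_real (\<Sum>b\<in>B. (cmod (ev b))\<^sup>2)" .
  have "gen_eigenspace T 0 = UNIV" if "trace (\<lambda>v. T (?S v)) = 0"
  proof -
    have "(\<Sum>b\<in>B. (cmod (ev b))\<^sup>2) = 0" using that tr by (simp del: of_real_sum of_real_power)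
    then have "ev b = 0" if "b \<in> B" for b
      using that fin by (simp add: sum_nonneg_eq_0_iff)
    with ev have "B \<subseteq> gen_eigenspace T 0" by force
    then show ?thesis using span_minimal[OF _ sub, of B 0] sp by auto
  qed
  with that[OF endoD] D show thesis by blast
qed

end

subsection \<open>Prelie products on simple Lie algebras\<close>

locale simple_prelie_algebra = fin_dim_complex_operator_space scale Basis + simple_lie_algebra scale bracket
  for scale :: "complex \<Rightarrow> 'a::ab_group_add \<Rightarrow> 'a" (infixr "*s" 75) and Basis bracket +
  fixes star :: "'a \<Rightarrow> 'a \<Rightarrow> 'a" (infixr "\<star>" 80)
  assumes prelie: "prelie_product scale star"
    and induces: "induces_bracket star bracket"
begin

section \<open>Left multiplications as a representation, and first consequences of
  simplicity\<close>

lemma endo_star: "endo (\<lambda>y. x \<star> y)" and endo_star_left: "endo (\<lambda>x. x \<star> y)"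
  using prelie by (auto simp: prelie_product_def bilinear_product_def eta_contract_eq)

lemma endo_bracket: "endo (bracket x)" and endo_bracket_left: "endo (\<lambda>x. bracket x y)"
  using bracket_bilinear by (auto simp: bilinear_product_def)

lemmas star_simps = endo_simps[OF endo_star] endo_simps[OF endo_star_left]
lemmas bracket_simps = endo_simps[OF endo_bracket] endo_simps[OF endo_bracket_left]

lemma bracket_eq: "bracket x y = x \<star> y - y \<star> x"
  using induces by (simp add: induces_bracket_def)

text \<open>A rearrangement of the prelie identity, which makes left multiplication a representation
  of the Lie algebra.\<close>

lemma star_bracket: "bracket x y \<star> z = x \<star> y \<star> z - y \<star> x \<star> z"
proof -
  have "(x \<star> y) \<star> z - x \<star> y \<star> z = (y \<star> x) \<star> z - y \<star> x \<star> z"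
    using prelie by (simp add: prelie_product_def)
  then show ?thesis by (simp add: bracket_eq star_simps algebra_simps)
qed

lemma bracket_bracket: "bracket (bracket x y) z = bracket x (bracket y z) - bracket y (bracket x z)"
proof -
  have anti: "bracket a b = - bracket b a" for a b by (simp add: bracket_eq)
  have "bracket y (bracket z x) = - bracket y (bracket x z)"
    by (subst anti[of z x]) (simp add: module_hom.neg[OF endo_bracket[unfolded linear_iff_module_hom]])
  with jacobi[of x y z] have "bracket z (bracket x y) = bracket y (bracket x z) - bracket x (bracket y z)"
    by (simp add: algebra_simps)
  then show ?thesis unfolding anti[of "bracket x y" z] by simp
qed

text \<open>The span of the brackets is a nonzero ideal, so simplicity makes the algebra
  perfect.\<close>

lemma bracket_span: "span {bracket x y |x y. True} = UNIV" (is "span ?D = _")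
proof -
  have D: "bracket x y \<in> span ?D" for x y by (intro span_base) blast
  then have "ideal (span ?D)" by (simp add: ideal_def)
  moreover have "span ?D \<noteq> {0}"
    using non_abelian D by auto
  ultimately show ?thesis using ideal_trivial by blast
qed

lemma subspace_bracketI:
  assumes "subspace A" "\<And>x y. bracket x y \<in> A" shows "y \<in> A"
  using span_minimal[OF _ assms(1), of "{bracket x y |x y. True}"] assms(2) bracket_span by blast

text \<open>The kernel of the representation is an ideal. It is proper, since a zero product would
  induce a zero bracket.\<close>

lemma star_faithful:
  assumes "\<And>v. x \<star> v = 0" shows "x = 0"
proof -
  let ?K = "{x. \<forall>v. x \<star> v = 0}"
  have "ideal ?K"
    by (auto simp: ideal_def star_bracket star_simps intro!: subspaceI)
  moreover have "?K \<noteq> UNIV"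
    using non_abelian by (auto simp: bracket_eq set_eq_iff) metis
  ultimately show ?thesis using ideal_trivial assms by blast
qed

text \<open>Weights add. By the Leibniz rule, \<open>shift (star x) (\<nu> + \<mu>)\<close> applied
  to \<open>a \<star> v\<close> is a sum of two terms, in each of which one factor is killed by a
  smaller power; the induction is on the sum of both exponents.\<close>

lemma star_gen_eigenspace:
  assumes "a \<in> gen_eigenspace (bracket x) \<mu>" "v \<in> gen_eigenspace (star x) \<nu>"
  shows "a \<star> v \<in> gen_eigenspace (star x) (\<nu> + \<mu>)"
proof -
  note sub = subspace_gen_eigenspace[OF endo_star]
  have "a \<star> v \<in> gen_eigenspace (star x) (\<nu> + \<mu>)"
    if "(shift (bracket x) \<mu> ^^ k) a = 0" "(shift (star x) \<nu> ^^ l) v = 0" for k l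
    using that
  proof (induction "k + l" arbitrary: k l a v)
    case 0
    then show ?case using subspace_0[OF sub] by (simp add: star_simps)
  next
    case (Suc n)
    show ?case
    proof (cases "k = 0 \<or> l = 0")
      case True
      then show ?thesis using Suc.prems subspace_0[OF sub] by (auto simp: star_simps)
    next
      case False
      then obtain k' l' where kl: "k = Suc k'" "l = Suc l'" by (metis not0_implies_Suc)
      have "shift (bracket x) \<mu> a \<star> v \<in> gen_eigenspace (star x) (\<nu> + \<mu>)"
        using Suc.prems Suc.hyps(2) kl by (intro Suc.hyps(1)[of k' l]) (auto simp: funpow_swap1)
      moreover have "a \<star> shift (star x) \<nu> v \<in> gen_eigenspace (star x) (\<nu> + \<mu>)"
        using Suc.prems Suc.hyps(2) kl by (intro Suc.hyps(1)[of k l']) (auto simp: funpow_swap1)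
      moreover have "shift (star x) (\<nu> + \<mu>) (a \<star> v) = shift (bracket x) \<mu> a \<star> v + a \<star> shift (star x) \<nu> v"
        by (simp add: shift_def star_simps star_bracket algebra_simps)
      ultimately show ?thesis
        using subspace_add[OF sub] gen_eigenspace_shift_iff[OF endo_star] by metis
    qed
  qed
  then show ?thesis using assms by (auto simp: gen_eigenspace_def)
qed

section \<open>The trace form of the left multiplications\<close>

definition trace_form :: "'a \<Rightarrow> 'a \<Rightarrow> complex"
  where "trace_form x y = trace (\<lambda>v. x \<star> y \<star> v)"

lemma star_nilpotent_of_trace_form_zero:
  assumes form: "\<And>x y. trace_form x y = 0"
  shows "gen_eigenspace (star x) 0 = UNIV"
proof -
  obtain S where S: "endo S" "\<And>\<mu> v. v \<in> gen_eigenspace (star x) \<mu> \<Longrightarrow> S v = cnj \<mu> *s v"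
    and tr: "trace (\<lambda>v. x \<star> S v) = 0 \<Longrightarrow> gen_eigenspace (star x) 0 = UNIV"
    using ex_conjugate_semisimple_part[OF endo_star] by blast
  have "trace (\<lambda>v. bracket a b \<star> S v) = 0" if b: "b \<in> gen_eigenspace (bracket x) \<mu>" for a b \<mu>
  proof -
    \<comment> \<open>Since \<open>cnj\<close> is additive, multiplying by \<open>b\<close>, which
      raises the weight \<open>\<nu>\<close> by \<open>\<mu>\<close>, raises the scalar by which
      \<open>S\<close> acts by \<open>cnj \<mu>\<close>.\<close>
    have comm: "S (b \<star> v) = b \<star> S v + cnj \<mu> *s (b \<star> v)" for v
    proof (rule endo_eq_on_span[of "\<lambda>v. S (b \<star> v)"])
      show "v \<in> span (\<Union>\<mu>. gen_eigenspace (star x) \<mu>)" by (simp add: span_gen_eigenspaces endo_star)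
      show "S (b \<star> v) = b \<star> S v + cnj \<mu> *s (b \<star> v)"
        if "v \<in> (\<Union>\<mu>. gen_eigenspace (star x) \<mu>)" for v
      proof -
        from that obtain \<nu> where v: "v \<in> gen_eigenspace (star x) \<nu>" by blast
        show ?thesis
          by (simp add: S(2)[OF v] S(2)[OF star_gen_eigenspace[OF b v]] star_simps algebra_simps)
      qed
    qed (intro endoI; simp add: endo_simps[OF S(1)] star_simps algebra_simps)+
    \<comment> \<open>Cyclicity and \<open>comm\<close> show that the trace of
      \<open>bracket a b\<close> after \<open>S\<close> is
      \<open>- cnj \<mu> * trace_form a b\<close>. By linearity in \<open>b\<close> and perfectness
      its vanishing extends to all left multiplications.\<close>
    have "trace (\<lambda>v. b \<star> a \<star> S v) = trace (\<lambda>v. a \<star> S (b \<star> v))"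
      by (rule trace_commute) (auto intro!: endoI simp: endo_simps[OF S(1)] star_simps)
    also have "\<dots> = trace (\<lambda>v. a \<star> b \<star> S v) + cnj \<mu> * trace_form a b"
      by (simp add: comm star_simps trace_add trace_scale trace_form_def)
    finally show ?thesis
      using form by (simp add: star_bracket trace_diff)
  qed
  moreover have "subspace {b. trace (\<lambda>v. bracket a b \<star> S v) = 0}" for a
    by (intro subspaceI)
      (simp_all add: star_simps bracket_simps trace_add trace_scale trace_zero)
  ultimately have "trace (\<lambda>v. bracket a b \<star> S v) = 0" for a b
    using span_minimal[of "\<Union>\<mu>. gen_eigenspace (bracket x) \<mu>" "{b. trace (\<lambda>v. bracket a b \<star> S v) = 0}"]
      span_gen_eigenspaces[OF endo_bracket] by blast
  moreover have "subspace {y. trace (\<lambda>v. y \<star> S v) = 0}"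
    by (intro subspaceI) (simp_all add: star_simps trace_add trace_scale trace_zero)
  ultimately have "x \<in> {y. trace (\<lambda>v. y \<star> S v) = 0}"
    by - (rule subspace_bracketI, simp_all)
  then show ?thesis using tr by simp
qed

text \<open>Commutators have trace 0 and brackets span the algebra. This serves both the left
  multiplications and the adjoint representation.\<close>

lemma trace_representation:
  assumes \<rho>: "\<And>x. endo (\<rho> x)" and lin: "\<And>v. endo (\<lambda>x. \<rho> x v)"
    and br: "\<And>x y v. \<rho> (bracket x y) v = \<rho> x (\<rho> y v) - \<rho> y (\<rho> x v)"
  shows "trace (\<rho> y) = 0"
proof -
  have "y \<in> {y. trace (\<rho> y) = 0}"
  proof (rule subspace_bracketI)
    have "\<rho> 0 = (\<lambda>v. 0)" "\<rho> (a + b) = (\<lambda>v. \<rho> a v + \<rho> b v)" "\<rho> (c *s a) = (\<lambda>v. c *s \<rho> a v)" for a b c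
      by (simp_all add: fun_eq_iff endo_simps[OF lin])
    then show "subspace {y. trace (\<rho> y) = 0}"
      by (intro subspaceI) (simp_all add: trace_add trace_scale trace_zero)
    have "\<rho> (bracket a b) = (\<lambda>v. \<rho> a (\<rho> b v) - \<rho> b (\<rho> a v))" for a b
      by (simp add: fun_eq_iff br)
    then show "bracket a b \<in> {y. trace (\<rho> y) = 0}" for a b
      using trace_commute[OF \<rho> \<rho>] by (simp add: trace_diff)
  qed
  then show ?thesis by simp
qed

lemma trace_star: "trace (star y) = 0"
  by (rule trace_representation) (simp_all add: endo_star endo_star_left star_bracket)

lemma trace_bracket: "trace (bracket y) = 0"
  by (rule trace_representation) (simp_all add: endo_bracket endo_bracket_left bracket_bracket)

lemma trace_star_left: "trace (\<lambda>x. x \<star> y) = 0"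
proof -
  have "(\<lambda>x. x \<star> y) = (\<lambda>x. y \<star> x - bracket y x)" by (simp add: bracket_eq)
  then show ?thesis by (simp add: trace_diff trace_star trace_bracket)
qed

lemma trace_form_simps:
  "trace_form (x + y) z = trace_form x z + trace_form y z"
  "trace_form z (x + y) = trace_form z x + trace_form z y"
  "trace_form (x - y) z = trace_form x z - trace_form y z"
  "trace_form z (x - y) = trace_form z x - trace_form z y"
  "trace_form (c *s x) z = c * trace_form x z"
  "trace_form z (c *s x) = c * trace_form z x"
  "trace_form 0 z = 0" "trace_form z 0 = 0"
  by (simp_all add: trace_form_def star_simps trace_add trace_diff trace_scale trace_zero)

lemma trace_form_sum:
  "trace_form (\<Sum>i\<in>I. f i) z = (\<Sum>i\<in>I. trace_form (f i) z)"
  "trace_form z (\<Sum>i\<in>I. f i) = (\<Sum>i\<in>I. trace_form z (f i))"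
  by (simp_all add: trace_form_def star_simps trace_sum)

lemma trace_form_commute: "trace_form x y = trace_form y x"
  unfolding trace_form_def by (intro trace_commute endo_star)

lemma trace_form_invariant: "trace_form (bracket x y) z = trace_form x (bracket y z)"
proof -
  have "trace (\<lambda>v. y \<star> x \<star> z \<star> v) = trace (\<lambda>v. x \<star> z \<star> y \<star> v)"
    by (rule trace_commute[of "star y" "\<lambda>v. x \<star> z \<star> v"]) (auto intro!: endoI simp: star_simps)
  then show ?thesis
    by (simp add: trace_form_def star_bracket star_simps trace_diff)
qed

text \<open>
  Engel's theorem: a maximal subalgebra \<open>S\<close> with \<open>killed S k = UNIV\<close> for some \<open>k\<close> is everything.
\<close>

definition killed :: "'a set \<Rightarrow> nat \<Rightarrow> 'a set"
  where "killed S i = {v. \<forall>xs. set xs \<subseteq> S \<and> length xs = i \<longrightarrow> foldr star xs v = 0}"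

lemma endo_foldr_star: "endo (foldr star xs)"
  by (induction xs) (auto intro!: endoI simp: endo_simps star_simps)

lemma subspace_killed: "subspace (killed S i)"
  by (intro subspaceI) (auto simp: killed_def endo_simps[OF endo_foldr_star])

lemma killed_0: "killed S 0 = {0}"
  by (simp add: killed_def)

text \<open>The last letter of a word acts first. Peeling it off gives the recursion of an ascending
  filtration that \<open>S\<close> lowers step by step.\<close>

lemma killed_Suc_iff: "v \<in> killed S (Suc i) \<longleftrightarrow> (\<forall>s\<in>S. s \<star> v \<in> killed S i)"
proof
  assume v: "v \<in> killed S (Suc i)"
  show "\<forall>s\<in>S. s \<star> v \<in> killed S i"
  proof
    fix s assume s: "s \<in> S"
    have "foldr star xs (s \<star> v) = 0" if "set xs \<subseteq> S" "length xs = i" for xs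
    proof -
      have "foldr star (xs @ [s]) v = 0" using v s that by (auto simp: killed_def simp del: foldr_append)
      then show ?thesis by simp
    qed
    then show "s \<star> v \<in> killed S i" by (simp add: killed_def)
  qed
next
  assume *: "\<forall>s\<in>S. s \<star> v \<in> killed S i"
  have "foldr star xs v = 0" if "set xs \<subseteq> S" "length xs = Suc i" for xs
  proof -
    from that(2) obtain ys s where "xs = ys @ [s]" "length ys = i" by (auto simp: length_Suc_conv_rev)
    with * that show ?thesis by (auto simp: killed_def)
  qed
  then show "v \<in> killed S (Suc i)" by (simp add: killed_def)
qed

lemma killed_mono: "killed S i \<subseteq> killed S (Suc i)"
proof (induction i)
  case 0
  then show ?case using subspace_0[OF subspace_killed] by (simp add: killed_0)
next
  case (Suc i)
  then show ?case using killed_Suc_iff[of _ S i] killed_Suc_iff[of _ S "Suc i"] by blast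
qed

lemma killed_UNIV_mono: "killed S k = UNIV \<Longrightarrow> k \<le> l \<Longrightarrow> killed S l = UNIV"
  using lift_Suc_mono_le[of "killed S" k l] killed_mono by auto

text \<open>Each bracket with \<open>s\<close> expands into \<open>s\<close> acting after
  \<open>a\<close>, which lowers the level of the result, minus \<open>s\<close> acting before
  \<open>a\<close>, which lowers the level of \<open>v\<close>. Without brackets the bound is
  trivial, as level \<open>k\<close> is already everything.\<close>

lemma foldr_bracket_killed:
  assumes k: "killed S k = UNIV" and xs: "set xs \<subseteq> S"
  shows "v \<in> killed S i \<Longrightarrow> foldr bracket xs a \<star> v \<in> killed S (i + k - length xs)"
  using xs
proof (induction xs arbitrary: v i)
  case Nil
  then show ?case using killed_UNIV_mono[OF k, of "i + k"] by simp
next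
  case (Cons s xs)
  let ?a = "foldr bracket xs a"
  show ?case
  proof (cases i)
    case 0
    then have "v = 0" using Cons.prems by (simp add: killed_0)
    then show ?thesis using subspace_0[OF subspace_killed] by (simp add: star_simps)
  next
    case (Suc j)
    have 1: "?a \<star> v \<in> killed S (i + k - length xs)" using Cons by auto
    have "s \<star> ?a \<star> v \<in> killed S (i + k - Suc (length xs))"
    \<comment> \<open>Truncated subtraction does no harm: level 0 contains only the zero
      vector.\<close>
    proof (cases "i + k - length xs")
      case 0
      then have "?a \<star> v = 0" using 1 by (simp add: killed_0)
      then show ?thesis using subspace_0[OF subspace_killed] by (simp add: star_simps)
    next
      case (Suc m)
      then have "i + k - Suc (length xs) = m" by simp
      then show ?thesis using 1 Cons.prems(2) unfolding Suc by (simp add: killed_Suc_iff)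
    qed
    moreover have "?a \<star> s \<star> v \<in> killed S (j + k - length xs)"
      using Cons.prems Suc by (intro Cons.IH) (auto simp: killed_Suc_iff)
    ultimately show ?thesis
      using subspace_diff[OF subspace_killed] Suc by (simp add: star_bracket)
  qed
qed

text \<open>Every vector has level \<open>k\<close>, so the left multiplication by a
  \<open>2 * k\<close>-fold bracket maps into level 0; faithfulness then makes the bracket itself
  0.\<close>

lemma foldr_bracket_eq_0:
  assumes "killed S k = UNIV" "set xs \<subseteq> S" "length xs = 2 * k"
  shows "foldr bracket xs a = 0"
proof (rule star_faithful)
  fix v
  have "foldr bracket xs a \<star> v \<in> killed S (k + k - length xs)"
    using foldr_bracket_killed[OF assms(1,2), of v k a] assms(1) by auto
  then show "foldr bracket xs a \<star> v = 0" using assms(3) by (simp add: killed_0 mult_2)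
qed

text \<open>Otherwise every element outside \<open>S\<close> would have a bracket with some element
  of \<open>S\<close> that stays outside. Iterated brackets would then never enter \<open>S\<close>,
  yet those of length \<open>2 * k\<close> are 0.\<close>

lemma ex_normalizing:
  assumes k: "killed S k = UNIV" and S: "0 \<in> S" "S \<noteq> UNIV"
  obtains w where "w \<notin> S" "\<And>s. s \<in> S \<Longrightarrow> bracket s w \<in> S"
proof (rule ccontr)
  assume "\<not> thesis"
  with that have *: "\<exists>s\<in>S. bracket s w \<notin> S" if "w \<notin> S" for w using that by blast
  obtain a where a: "a \<notin> S" using S by blast
  have "\<exists>xs. set xs \<subseteq> S \<and> length xs = n \<and> foldr bracket xs a \<notin> S" for n
  proof (induction n)
    case 0
    then show ?case using a by auto
  next
    case (Suc n)
    then obtain xs where xs: "set xs \<subseteq> S" "length xs = n" "foldr bracket xs a \<notin> S" by blast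
    with * obtain s where "s \<in> S" "bracket s (foldr bracket xs a) \<notin> S" by blast
    with xs show ?case by (intro exI[of _ "s # xs"]) auto
  qed
  with foldr_bracket_eq_0[OF k] S(1) show False by metis
qed

text \<open>Moving \<open>s\<close> past \<open>w\<close> costs the term \<open>bracket s w\<close>,
  which again lies in \<open>S\<close> and lowers the level.\<close>

lemma killed_invariant:
  assumes w: "\<And>s. s \<in> S \<Longrightarrow> bracket s w \<in> S"
  shows "v \<in> killed S i \<Longrightarrow> w \<star> v \<in> killed S i"
proof (induction i arbitrary: v)
  case 0
  then show ?case by (simp add: killed_0 star_simps)
next
  case (Suc i)
  show ?case unfolding killed_Suc_iff
  proof
    fix s assume s: "s \<in> S"
    have "s \<star> w \<star> v = bracket s w \<star> v + w \<star> s \<star> v" by (simp add: star_bracket)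
    moreover have "bracket s w \<star> v \<in> killed S i" using Suc.prems w[OF s] by (simp add: killed_Suc_iff)
    moreover have "w \<star> s \<star> v \<in> killed S i" using Suc s by (simp add: killed_Suc_iff)
    ultimately show "s \<star> w \<star> v \<in> killed S i" using subspace_add[OF subspace_killed] by simp
  qed
qed

text \<open>On the quotient of two consecutive levels \<open>S\<close> acts as 0, so only powers of
  \<open>w\<close> survive, and \<open>m\<close> letters lower the level by one.\<close>

lemma killed_span_insert:
  assumes S: "subspace S" and k: "killed S k = UNIV" and w: "\<And>s. s \<in> S \<Longrightarrow> bracket s w \<in> S"
    and m: "\<And>v. (star w ^^ m) v = 0"
  shows "killed (span (insert w S)) (m * k) = UNIV"
proof -
  let ?S' = "span (insert w S)"
  have sub: "subspace (killed S i)" for i by (rule subspace_killed)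
  have inv: "(star w ^^ l) v \<in> killed S i" if "v \<in> killed S i" for l v i
    using that by (induction l) (auto intro: killed_invariant[OF w])
  have mod: "\<exists>c. foldr star xs v - c *s (star w ^^ length xs) v \<in> killed S i"
    if "set xs \<subseteq> ?S'" "v \<in> killed S (Suc i)" for xs v i
    using that(1)
  proof (induction xs)
    case Nil
    then show ?case using subspace_0[OF sub] by (auto intro!: exI[of _ 1])
  next
    case (Cons x xs)
    then obtain c where c: "foldr star xs v - c *s (star w ^^ length xs) v \<in> killed S i" (is "?u \<in> _") by auto
    from Cons.prems have "x \<in> span (insert w S)" by simp
    then obtain d where d: "x - d *s w \<in> S"
      using S by (auto simp: span_breakdown_eq span_eq_iff[THEN iffD2])
    let ?p = "(star w ^^ length xs) v"
    have split: "foldr star (x # xs) v - (d * c) *s (star w ^^ length (x # xs)) v =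
        (x - d *s w) \<star> ?u + c *s ((x - d *s w) \<star> ?p) + d *s (w \<star> ?u)"
      by (simp add: star_simps algebra_simps)
    have "(x - d *s w) \<star> ?u \<in> killed S i"
      using d killed_mono[of S i] c by (auto simp: killed_Suc_iff)
    moreover have "(x - d *s w) \<star> ?p \<in> killed S i"
      using d inv[OF that(2)] by (simp add: killed_Suc_iff)
    moreover have "w \<star> ?u \<in> killed S i" by (rule killed_invariant[OF w c])
    ultimately have "foldr star (x # xs) v - (d * c) *s (star w ^^ length (x # xs)) v \<in> killed S i"
      unfolding split by (intro subspace_add[OF sub] subspace_scale[OF sub])
    then show ?case by blast
  qed
  have "killed S i \<subseteq> killed ?S' (m * i)" for i
  proof (induction i)
    case 0
    then show ?case by (simp add: killed_0)
  next
    case (Suc i)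
    show ?case
    proof
      fix v assume v: "v \<in> killed S (Suc i)"
      have "foldr star xs v = 0" if xs: "set xs \<subseteq> ?S'" "length xs = m * Suc i" for xs
      proof -
        \<comment> \<open>The last \<open>m\<close> letters, \<open>?zs\<close>, act first and lower
          the level once; the induction hypothesis handles the rest.\<close>
        let ?ys = "take (m * i) xs" and ?zs = "drop (m * i) xs"
        have "length ?zs = m" "length ?ys = m * i" using xs(2) by simp_all
        moreover have "set ?ys \<subseteq> ?S'" "set ?zs \<subseteq> ?S'"
          using xs(1) set_take_subset set_drop_subset by (meson order_trans)+
        ultimately have "foldr star ?zs v \<in> killed S i" using mod[of ?zs v i] v m by auto
        with Suc.IH have "foldr star ?zs v \<in> killed ?S' (m * i)" by blast
        then have "foldr star ?ys (foldr star ?zs v) = 0"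
          using \<open>length ?ys = m * i\<close> \<open>set ?ys \<subseteq> ?S'\<close> by (simp add: killed_def)
        then show ?thesis by (metis append_take_drop_id foldr_append comp_apply)
      qed
      then show "v \<in> killed ?S' (m * Suc i)" by (simp add: killed_def)
    qed
  qed
  with k show ?thesis by blast
qed

text \<open>If level \<open>Suc k\<close> is everything, then level \<open>k\<close> contains all
  products, hence all brackets, hence everything by perfectness. This descends to level 0, which is
  \<open>{0}\<close>.\<close>

lemma killed_UNIV: "killed UNIV k \<noteq> UNIV"
proof (induction k)
  case 0
  have "\<exists>x::'a. x \<noteq> 0" using non_abelian by blast
  then show ?case by (auto simp: killed_0)
next
  case (Suc k)
  show ?case
  proof
    assume "killed UNIV (Suc k) = UNIV"
    then have "s \<star> v \<in> killed UNIV k" for s v by (auto simp: set_eq_iff killed_Suc_iff)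
    then have "bracket x y \<in> killed UNIV k" for x y
      unfolding bracket_eq by (intro subspace_diff[OF subspace_killed])
    with Suc subspace_bracketI[OF subspace_killed] show False by blast
  qed
qed

text \<open>A uniform exponent is the sum of the exponents for the finitely many basis
  vectors.\<close>

lemma funpow_star_eq_0:
  assumes "gen_eigenspace (star w) 0 = UNIV"
  shows "\<exists>m. \<forall>v. (star w ^^ m) v = 0"
proof -
  have "\<exists>k. (star w ^^ k) b = 0" for b
    using assms by (auto simp: set_eq_iff gen_eigenspace_def shift_zero)
  then obtain k where k: "(star w ^^ k b) b = 0" for b by metis
  define m where "m = (\<Sum>b\<in>Basis. k b)"
  have "(star w ^^ m) b = 0" if "b \<in> Basis" for b
    using funpow_endo_mono[OF endo_star k[of b]] member_le_sum[of b Basis k] that finite_Basis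
    by (simp add: m_def)
  then have "(star w ^^ m) v = 0" for v
    using endo_eq_on_span[of "star w ^^ m" "\<lambda>_. 0" Basis v] endo_funpow[OF endo_star]
    by (simp add: span_Basis endoI)
  then show ?thesis by blast
qed

text \<open>If the form vanished, all left multiplications would be nilpotent. A subalgebra of
  maximal dimension among those acting nilpotently is proper by \<open>killed_UNIV\<close>, but a
  normalizing element outside it would enlarge it.\<close>

lemma trace_form_nonzero: "\<exists>x y. trace_form x y \<noteq> 0"
proof (rule ccontr)
  assume "\<not> ?thesis"
  then have nil: "gen_eigenspace (star x) 0 = UNIV" for x
    by (intro star_nilpotent_of_trace_form_zero) blast
  define P where "P S \<longleftrightarrow> subspace S \<and> (\<forall>x\<in>S. \<forall>y\<in>S. bracket x y \<in> S) \<and> (\<exists>k. killed S k = UNIV)" for S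
  have "P {0}"
    by (auto simp: P_def bracket_simps killed_def star_simps set_eq_iff intro!: exI[of _ 1])
       (auto simp: length_Suc_conv star_simps)
  moreover have "\<forall>S. P S \<longrightarrow> dim S < Suc (dim UNIV)"
    by (simp add: dim_subset less_Suc_eq_le del: dim_UNIV)
  ultimately obtain S where "P S" and max: "\<And>S'. P S' \<Longrightarrow> dim S' \<le> dim S"
    using ex_has_greatest_nat[of P "{0}" dim] by blast
  then obtain k where S: "subspace S" "\<And>x y. x \<in> S \<Longrightarrow> y \<in> S \<Longrightarrow> bracket x y \<in> S"
    and k: "killed S k = UNIV" by (auto simp: P_def)
  have "S \<noteq> UNIV" using k killed_UNIV by blast
  then obtain w where w: "w \<notin> S" "\<And>s. s \<in> S \<Longrightarrow> bracket s w \<in> S"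
    using ex_normalizing[OF k subspace_0[OF S(1)]] by blast
  obtain m where "\<And>v. (star w ^^ m) v = 0" using funpow_star_eq_0[OF nil] by blast
  from killed_span_insert[OF S(1) k w(2) this] have kill: "killed (span (insert w S)) (m * k) = UNIV" .
  have "bracket x y \<in> span (insert w S)" if xy: "x \<in> span (insert w S)" "y \<in> span (insert w S)" for x y
  proof -
    obtain c d where c: "x - c *s w \<in> S" "y - d *s w \<in> S"
      using xy S(1) by (auto simp: span_breakdown_eq span_eq_iff[THEN iffD2])
    have "bracket x y = bracket (x - c *s w) (y - d *s w) + d *s bracket (x - c *s w) w
        - c *s bracket (y - d *s w) w"
      by (simp add: bracket_eq star_simps algebra_simps)
    also have "\<dots> \<in> S"
      using c S w by (intro subspace_add subspace_diff subspace_scale)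
    finally show ?thesis using span_superset by blast
  qed
  with kill have "P (span (insert w S))" by (auto simp: P_def)
  moreover have "dim S < dim (span (insert w S))"
    using w(1) S(1) span_superset[of "insert w S"]
    by (intro dim_psubset) (auto simp: span_eq_iff[THEN iffD2])
  ultimately show False using max by (metis not_le)
qed

section \<open>Nondegeneracy and dual bases\<close>

lemma trace_form_nondegenerate:
  assumes "\<And>y. trace_form x y = 0" shows "x = 0"
proof -
  let ?R = "{x. \<forall>y. trace_form x y = 0}"
  \<comment> \<open>The radical of the form is an ideal by invariance, and proper because the form
    is nonzero.\<close>
  have "ideal ?R"
  proof -
    have "trace_form (bracket x y) z = 0" if "\<forall>z. trace_form y z = 0" for x y z
    proof -
      have "bracket x y = - bracket y x" by (simp add: bracket_eq)
      then have "trace_form (bracket x y) z = - trace_form (bracket y x) z"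
        using trace_form_simps(3)[of 0 "bracket y x" z] by (simp add: trace_form_simps(7))
      with that show ?thesis by (simp add: trace_form_invariant)
    qed
    then show ?thesis
      by (auto simp: ideal_def trace_form_simps intro!: subspaceI)
  qed
  moreover have "?R \<noteq> UNIV" using trace_form_nonzero by (auto simp: set_eq_iff)
  ultimately show ?thesis using ideal_trivial assms by blast
qed

lemma ex_dual_basis:
  obtains d where "\<And>b v. b \<in> Basis \<Longrightarrow> trace_form (d b) v = representation Basis v b"
    "\<And>v. v = (\<Sum>b\<in>Basis. trace_form v b *s d b)"
proof -
  interpret pair: finite_dimensional_vector_space_pair scale Basis scale Basis ..
  \<comment> \<open>The map from the space to its dual given by the form, with the dual written in
    coordinates. It is injective by nondegeneracy, hence bijective, and \<open>d b\<close> is the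
    preimage of \<open>b\<close>.\<close>
  define \<phi> where "\<phi> x = (\<Sum>b\<in>Basis. trace_form x b *s b)" for x
  have lin: "endo \<phi>"
    by (intro endoI) (simp_all add: \<phi>_def trace_form_simps algebra_simps sum.distrib scale_sum_right)
  have coeff: "representation Basis (\<phi> x) b = trace_form x b" if "b \<in> Basis" for x b
    unfolding \<phi>_def
    by (subst representation_sum[OF independent_Basis])
      (auto simp: span_Basis representation_scale[OF independent_Basis] representation_basis[OF independent_Basis]
         that finite_Basis if_distrib cong: if_cong)
  have zero: "x = 0" if "\<And>b. b \<in> Basis \<Longrightarrow> trace_form x b = 0" for x
  proof (rule trace_form_nondegenerate)
    fix y
    have "trace_form x y = trace_form x (\<Sum>b\<in>Basis. representation Basis y b *s b)"
      by (simp only: sum_representation[OF Basis_basis])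
    then show "trace_form x y = 0" using that by (simp add: trace_form_sum trace_form_simps)
  qed
  have "x = 0" if "\<phi> x = 0" for x
    using zero coeff[of _ x] that by (metis representation_zero)
  then have "inj \<phi>" using module_hom.inj_iff_eq_0 lin by (auto simp: linear_iff_module_hom)
  then have "surj \<phi>" using pair.linear_injective_imp_surjective[OF lin] by simp
  then obtain d where d: "\<And>b. \<phi> (d b) = b" by (metis surj_def)
  have form: "trace_form (d b) v = representation Basis v b" if b: "b \<in> Basis" for b v
  proof -
    have "trace_form (d b) v = trace_form (d b) (\<Sum>c\<in>Basis. representation Basis v c *s c)"
      by (simp only: sum_representation[OF Basis_basis])
    also have "\<dots> = (\<Sum>c\<in>Basis. representation Basis v c * representation Basis b c)"
      by (simp add: trace_form_sum trace_form_simps coeff[symmetric] d cong: sum.cong)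
    also have "\<dots> = representation Basis v b"
      using b finite_Basis by (simp add: representation_basis[OF independent_Basis] if_distrib cong: if_cong)
    finally show ?thesis .
  qed
  have "v = (\<Sum>b\<in>Basis. trace_form v b *s d b)" for v
  proof (rule iffD1[OF right_minus_eq zero])
    fix c assume c: "c \<in> Basis"
    have "(\<Sum>b\<in>Basis. trace_form v b * trace_form (d b) c) = trace_form v c"
      using c finite_Basis
      by (simp add: form representation_basis[OF independent_Basis] if_distrib cong: if_cong)
    then show "trace_form (v - (\<Sum>b\<in>Basis. trace_form v b *s d b)) c = 0"
      by (simp add: trace_form_simps trace_form_sum)
  qed
  with form show thesis by (rule that)
qed

text \<open>
  The Casimir operator of the left multiplications is itself a right multiplication, because
  the identity is a cocycle for them.
\<close>

lemma no_simple_prelie_algebra: False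
proof -
  obtain d where d: "\<And>b v. b \<in> Basis \<Longrightarrow> trace_form (d b) v = representation Basis v b"
    and dual: "\<And>v. v = (\<Sum>b\<in>Basis. trace_form v b *s d b)"
    using ex_dual_basis by blast
  define e where "e = (\<Sum>b\<in>Basis. b \<star> d b)"
  have casimir: "x \<star> e = (\<Sum>b\<in>Basis. b \<star> d b \<star> x)" for x
  proof -
    have l: "bracket x b = (\<Sum>c\<in>Basis. trace_form (d c) (bracket x b) *s c)" for b
      using sum_representation[OF Basis_basis, of "bracket x b"] by (simp add: d cong: sum.cong)
    have r: "bracket x (d b) = (\<Sum>c\<in>Basis. trace_form (bracket x (d b)) c *s d c)" for b
      by (rule dual)
    \<comment> \<open>By invariance the matrices of \<open>bracket x\<close> in the two dual bases
      are negative transposes of each other, so the two sums in \<open>cancel\<close> are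
      opposite.\<close>
    have inv: "trace_form (d c) (bracket x b) = - trace_form (bracket x (d c)) b" for b c
    proof -
      have "bracket (d c) x = - bracket x (d c)" by (simp add: bracket_eq)
      then show ?thesis
        using trace_form_simps(3)[of 0 "bracket x (d c)" b]
        by (simp add: trace_form_invariant[symmetric] trace_form_simps(7))
    qed
    have "(\<Sum>b\<in>Basis. bracket x b \<star> d b) = (\<Sum>b\<in>Basis. \<Sum>c\<in>Basis. trace_form (d c) (bracket x b) *s (c \<star> d b))"
      by (subst l) (simp add: star_simps)
    also have "\<dots> = (\<Sum>c\<in>Basis. \<Sum>b\<in>Basis. trace_form (d c) (bracket x b) *s (c \<star> d b))"
      by (rule sum.swap)
    also have "\<dots> = - (\<Sum>c\<in>Basis. \<Sum>b\<in>Basis. trace_form (bracket x (d c)) b *s (c \<star> d b))"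
      by (simp add: inv sum_negf)
    also have "\<dots> = - (\<Sum>c\<in>Basis. c \<star> bracket x (d c))"
      by (subst r) (simp add: star_simps)
    finally have cancel: "(\<Sum>b\<in>Basis. bracket x b \<star> d b) + (\<Sum>b\<in>Basis. b \<star> bracket x (d b)) = 0"
      by simp
    \<comment> \<open>Here \<open>x\<close> is moved to the right, first past \<open>b\<close> by
      the representation property, then past \<open>d b\<close> by
      \<open>x \<star> d b = d b \<star> x + bracket x (d b)\<close>, the cocycle property of the
      identity.\<close>
    have "x \<star> b \<star> d b = b \<star> d b \<star> x + (bracket x b \<star> d b + b \<star> bracket x (d b))" for b
      by (simp add: star_bracket) (simp add: bracket_eq star_simps)
    then have "x \<star> e = (\<Sum>b\<in>Basis. b \<star> d b \<star> x) +
        ((\<Sum>b\<in>Basis. bracket x b \<star> d b) + (\<Sum>b\<in>Basis. b \<star> bracket x (d b)))"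
      by (simp add: e_def star_simps sum.distrib)
    with cancel show ?thesis by simp
  qed
  \<comment> \<open>Right multiplication by \<open>e\<close> has trace 0, while each basis vector
    contributes 1 to the trace of the Casimir operator; in characteristic 0 this leaves no basis
    vectors.\<close>
  have "0 = trace (\<lambda>x. x \<star> e)" by (simp add: trace_star_left)
  also have "\<dots> = (\<Sum>b\<in>Basis. trace_form b (d b))"
    by (simp add: casimir trace_sum trace_form_def)
  also have "\<dots> = (\<Sum>b\<in>Basis. 1)"
    by (intro sum.cong refl)
      (simp add: trace_form_commute[of _ "d _"] d representation_basis[OF independent_Basis])
  finally have "Basis = {}" using finite_Basis by simp
  then have "bracket x y = 0" for x y using span_Basis span_empty by blast
  then show False using non_abelian by blast
qed

end

theorem theorem24:
  fixes scale :: "complex \<Rightarrow> 'a::ab_group_add \<Rightarrow> 'a"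
    and bracket :: "'a \<Rightarrow> 'a \<Rightarrow> 'a"
  assumes "simple_lie_algebra scale bracket"
    and "\<exists>Basis. finite_dimensional_vector_space scale Basis"
    and "\<not> lie_isomorphic scale bracket f4_scale f4_bracket"
  shows "\<not> is_prelie scale bracket"
proof
  assume "is_prelie scale bracket"
  then obtain star where star: "prelie_product scale star" "induces_bracket star bracket"
    by (auto simp: is_prelie_def)
  from assms(2) obtain Basis where "finite_dimensional_vector_space scale Basis" by blast
  interpret g: simple_lie_algebra scale bracket by (rule assms(1))
  interpret V: finite_dimensional_vector_space scale Basis by fact
  interpret simple_prelie_algebra scale Basis bracket star
    by unfold_locales (use star in auto)
  show False by (rule no_simple_prelie_algebra)
qed

end
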